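(* Let $\lambda_1,\lambda_2$ be fixed numbers. For $f\in Lip_M^{\lambda_1,\lambda_2}(s)$ and $0<s\le 1$, the following inequality holds: $$\left|\mathcal{U}_{n}^{[\alpha]}(f;x)-f(x)\right|\leq M\left(\frac{\Theta_{n,2}^{[\alpha]}(x)}{x(x\lambda_1+\lambda_2)}\right)^{\frac s2}.$$
   Context: For $n\in\mathbb{N}$, $\alpha=\alpha_n$ with $0\le\alpha_n\le\frac1n$, $x\in[0,\infty)$, and $f$ integrable and bounded on $[0,\infty)$, the operators are $$\mathcal{U}_{n}^{[\alpha]}(f;x)=n\sum_{i=0}^{\infty}(1+n\alpha)^{\frac{-x}{\alpha}}\left(\alpha+\frac1n\right)^{-i}\frac{x^{(i,-\alpha)}}{i!}\int_0^\infty e^{-nu}\frac{(nu)^i}{i!}f(u)\,du,$$ where $x^{(0,-\alpha)}=1$ and $x^{(i,-\alpha)}=x(x+\alpha)\cdots(x+(i-1)\alpha)$. As $\alpha\to0$ they reduce to the Szász-Mirakjan-Durrmeyer operators $n\sum_{i=0}^{\infty}e^{-nx}\frac{(nx)^i}{i!}\int_0^\infty e^{-nu}\frac{(nu)^i}{i!}f(u)\,du$. $\Theta_{n,2}^{[\alpha]}(x)=\mathcal{U}_{n}^{[\alpha]}((t-x)^2;x)=\frac{\alpha n^2x+2nx+2}{n^2}$ is the second central moment, the operator acting on the variable $t$. $C_B[0,\infty)$ is the set of all continuous and bounded functions on $[0,\infty)$. For fixed numbers $\lambda_1,\lambda_2$ and $s\in(0,1]$, the modified Lipschitz-type space is $$Lip_M^{\lambda_1,\lambda_2}(s)=\left\{f\in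 C_B[0,\infty):|f(j)-f(k)|\le M\frac{|j-k|^s}{\left(j+k^2\lambda_1+k\lambda_2\right)^{\frac s2}},\ \text{where } j,k\ge0 \text{ are variables}\right\},$$ with $M$ the constant appearing in the inequality. *)

theory Defs
  imports "HOL-Analysis.Analysis"
begin

text \<open>\<open>step_factorial x i \<alpha>\<close> is the factorial power \<open>x(x+\<alpha>)\<dots>(x+(i-1)\<alpha>)\<close>, written
  \<open>x^(i,-\<alpha>)\<close> in the literature.\<close>

definition step_factorial :: "real \<Rightarrow> nat \<Rightarrow> real \<Rightarrow> real" where
  "step_factorial x i \<alpha> = (\<Prod>k<i. x + real k * \<alpha>)"

text \<open>The exponent \<open>-x/\<alpha>\<close> has no meaning at \<open>\<alpha> = 0\<close>; there the weight is the limit for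
  \<open>\<alpha> \<rightarrow> 0\<close>, which gives the Szasz-Mirakjan-Durrmeyer operators.\<close>

definition weight :: "nat \<Rightarrow> real \<Rightarrow> real \<Rightarrow> nat \<Rightarrow> real" where
  "weight n \<alpha> x i =
     (if \<alpha> = 0 then exp (- (real n * x)) * (real n * x) ^ i / fact i
      else (1 + real n * \<alpha>) powr (- x / \<alpha>) * (\<alpha> + 1 / real n) powi (- int i)
             * (step_factorial x i \<alpha> / fact i))"

definition U_op :: "nat \<Rightarrow> real \<Rightarrow> (real \<Rightarrow> real) \<Rightarrow> real \<Rightarrow> real" where
  "U_op n \<alpha> f x =
     real n * (\<Sum>i. weight n \<alpha> x i *
       (LBINT u:{0..}. exp (- (real n * u)) * ((real n * u) ^ i / fact i) * f u))"

definition second_central_moment :: "nat \<Rightarrow> real \<Rightarrow> real \<Rightarrow> real" where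
  "second_central_moment n \<alpha> x = U_op n \<alpha> (\<lambda>t. (t - x)\<^sup>2) x"

text \<open>Functions on \<open>[0,\<infinity>)\<close> are total functions of which only the values on \<open>{0..}\<close> matter.\<close>

definition CB :: "(real \<Rightarrow> real) set" where
  "CB = {f. continuous_on {0..} f \<and> bounded (f ` {0..})}"

text \<open>The Lipschitz inequality is imposed at the points \<open>j, k \<ge> 0\<close> at which its right-hand side is
  meaningful, that is, where the base of the fractional power in the denominator is positive.
  For \<open>l1, l2 \<ge> 0\<close> not both zero this leaves out only \<open>j = k = 0\<close>, where both
  \<open>|f j - f k|\<close> and \<open>|j - k|\<close> vanish.\<close>

definition Lip :: "real \<Rightarrow> real \<Rightarrow> real \<Rightarrow> real \<Rightarrow> (real \<Rightarrow> real) set" where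
  "Lip M l1 l2 s =
     {f \<in> CB. \<forall>j\<ge>0. \<forall>k\<ge>0. 0 < j + k\<^sup>2 * l1 + k * l2 \<longrightarrow>
        \<bar>f j - f k\<bar> \<le> M * (\<bar>j - k\<bar> powr s / (j + k\<^sup>2 * l1 + k * l2) powr (s / 2))}"

end

theory Submission
  imports Defs "HOL-Probability.Distributions" "HOL-Real_Asymp.Real_Asymp"
begin

text \<open>The operator is positive and linear and reproduces constants. On \<open>Lip\<close> the deviation
  \<open>\<bar>f t - f x\<bar>\<close> is at most \<open>M ((t - x)\<^sup>2 / c) powr (s / 2)\<close> with \<open>c = x (x l1 + l2)\<close>. Hoelder's inequality
  for the operator is replaced by the tangent line of the concave function \<open>y \<mapsto> y powr (s / 2)\<close> at
  \<open>y = \<Theta>\<close>: this majorant is affine in \<open>(t - x)\<^sup>2\<close>, so the operator maps it exactly to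
  \<open>\<Theta> powr (s / 2)\<close>.\<close>

section \<open>Moments of the gamma kernel\<close>

text \<open>On \<open>{0..}\<close> this is 1/n times the gamma density of shape i+1 and rate n. It
  is the part of the integrand in \<open>U_op\<close> that does not involve f.\<close>

definition gamma_kernel :: "nat \<Rightarrow> nat \<Rightarrow> real \<Rightarrow> real" where
  "gamma_kernel n i u = exp (- (real n * u)) * ((real n * u) ^ i / fact i)"

lemma gamma_kernel_nonneg: "0 \<le> u \<Longrightarrow> 0 \<le> gamma_kernel n i u"
  by (simp add: gamma_kernel_def)

lemma gamma_kernel_erlang:
  "n > 0 \<Longrightarrow> indicator {0..} u * gamma_kernel n i u = erlang_density i (real n) u / real n"
  by (auto simp: gamma_kernel_def erlang_density_def indicator_def power_mult_distrib)

lemma gamma_kernel_moment: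
  assumes "n > 0"
  shows "set_integrable lborel {0..} (\<lambda>u. gamma_kernel n i u * u ^ k)"
    and "(LBINT u:{0..}. gamma_kernel n i u * u ^ k) = fact (i + k) / (fact i * real n ^ Suc k)"
proof -
  have "has_bochner_integral lborel (\<lambda>u. erlang_density i (real n) u * u ^ k / real n)
      (fact (i + k) / (fact i * real n ^ k) / real n)"
    using assms nn_integral_erlang_ith_moment[of "real n" i k]
    by (intro has_bochner_integral_divide_zero has_bochner_integral_nn_integral)
       (auto simp: erlang_density_def)
  also have "(\<lambda>u. erlang_density i (real n) u * u ^ k / real n)
      = (\<lambda>u. indicator {0..} u *\<^sub>R (gamma_kernel n i u * u ^ k))"
    by (simp add: gamma_kernel_erlang[OF assms] flip: mult.assoc)
  finally show "set_integrable lborel {0..} (\<lambda>u. gamma_kernel n i u * u ^ k)"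
    and "(LBINT u:{0..}. gamma_kernel n i u * u ^ k) = fact (i + k) / (fact i * real n ^ Suc k)"
    by (auto simp: has_bochner_integral_iff set_integrable_def set_lebesgue_integral_def mult_ac)
qed

lemma gamma_kernel_integral_one:
  assumes "n > 0"
  shows "set_integrable lborel {0..} (gamma_kernel n i)"
    and "(LBINT u:{0..}. gamma_kernel n i u) = 1 / real n"
  using gamma_kernel_moment[OF assms, of i 0] by simp_all

text \<open>The gamma law has mean (i+1)/n and variance (i+1)/n^2, so the value is squared bias plus
  variance, scaled by the kernel's total mass 1/n. In this form strict positivity and quadratic
  growth in i can be read off.\<close>

lemma gamma_kernel_second_moment:
  assumes "n > 0"
  shows "set_integrable lborel {0..} (\<lambda>u. gamma_kernel n i u * (u - x)\<^sup>2)"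
    and "(LBINT u:{0..}. gamma_kernel n i u * (u - x)\<^sup>2)
           = ((real i + 1) / real n - x)\<^sup>2 / real n + (real i + 1) / real n ^ 3"
proof -
  note m = gamma_kernel_moment[OF assms, of i]
  have eq: "gamma_kernel n i u * (u - x)\<^sup>2 = gamma_kernel n i u * u ^ 2
      - 2 * x * (gamma_kernel n i u * u ^ 1) + x\<^sup>2 * (gamma_kernel n i u * u ^ 0)" for u
    by (simp add: power2_eq_square algebra_simps)
  show "set_integrable lborel {0..} (\<lambda>u. gamma_kernel n i u * (u - x)\<^sup>2)"
    unfolding eq
    by (rule set_integral_add(1) set_integral_diff(1) set_integrable_mult_right impI m(1))+
  have "(LBINT u:{0..}. gamma_kernel n i u * (u - x)\<^sup>2)
      = (LBINT u:{0..}. gamma_kernel n i u * u ^ 2)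
        - 2 * x * (LBINT u:{0..}. gamma_kernel n i u * u ^ 1)
        + x\<^sup>2 * (LBINT u:{0..}. gamma_kernel n i u * u ^ 0)"
    unfolding eq
    by (subst set_integral_add(2) set_integral_diff(2) set_integral_mult_right,
        (rule set_integral_diff(1) set_integrable_mult_right impI m(1))+)+ simp
  also have "\<dots> = (real i + 2) * (real i + 1) / real n ^ 3 - 2 * x * ((real i + 1) / real n ^ 2) + x\<^sup>2 / real n"
  proof -
    have "fact (i + 2) = (real i + 2) * (real i + 1) * fact i" "fact (i + 1) = (real i + 1) * fact i"
      by (simp_all add: eval_nat_numeral algebra_simps)
    then show ?thesis
      unfolding m(2) by (simp add: power2_eq_square power3_eq_cube del: fact_Suc)
  qed
  also have "\<dots> = ((real i + 1) / real n - x)\<^sup>2 / real n + (real i + 1) / real n ^ 3"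
    using assms by (simp add: field_simps power2_eq_square power3_eq_cube)
  finally show "(LBINT u:{0..}. gamma_kernel n i u * (u - x)\<^sup>2)
           = ((real i + 1) / real n - x)\<^sup>2 / real n + (real i + 1) / real n ^ 3" .
qed

section \<open>The weights: recursion, total mass and decay\<close>

lemma weight_0_pos: "n > 0 \<Longrightarrow> 0 \<le> \<alpha> \<Longrightarrow> 0 < weight n \<alpha> x 0"
  using add_pos_nonneg[of 1 "real n * \<alpha>"] by (auto simp: weight_def step_factorial_def)

lemma weight_nonneg: "0 \<le> \<alpha> \<Longrightarrow> 0 \<le> x \<Longrightarrow> 0 \<le> weight n \<alpha> x i"
  by (auto simp: weight_def step_factorial_def zero_le_power_int intro!: mult_nonneg_nonneg divide_nonneg_pos prod_nonneg)

text \<open>One ratio of consecutive weights covers both branches of \<open>weight\<close>, so the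
  ratio test below needs no case split on \<open>\<alpha>\<close>.\<close>

lemma weight_Suc:
  assumes "n > 0" "0 \<le> \<alpha>"
  shows "weight n \<alpha> x (Suc i)
           = (x + real i * \<alpha>) / ((real i + 1) * (\<alpha> + 1 / real n)) * weight n \<alpha> x i"
proof (cases "\<alpha> = 0")
  case True
  then show ?thesis using assms by (simp add: weight_def field_simps)
next
  case False
  then have "\<alpha> + 1 / real n > 0" using assms by (simp add: add_pos_nonneg)
  then show ?thesis using False
    by (simp add: weight_def step_factorial_def power_int_minus field_simps del: of_nat_Suc)
       (simp add: algebra_simps)
qed

text \<open>For \<open>\<alpha> = 0\<close> this is the exponential series times exp(-nx). For
  \<open>\<alpha> > 0\<close> it is the binomial series with exponent \<open>- x / \<alpha>\<close>
  at \<open>- z\<close>, whose sum is cancelled by the prefactor. It makes the operator reproduce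
  constants.\<close>

lemma weight_sums_1:
  assumes "n > 0" "0 \<le> \<alpha>"
  shows "weight n \<alpha> x sums 1"
proof (cases "\<alpha> = 0")
  case True
  have "(\<lambda>i. exp (- (real n * x)) * ((real n * x) ^ i /\<^sub>R fact i)) sums
      (exp (- (real n * x)) * exp (real n * x))"
    by (intro sums_mult exp_converges)
  then show ?thesis
    using True by (simp add: weight_def[abs_def] field_simps flip: exp_add)
next
  case False
  with assms have \<alpha>: "\<alpha> > 0" by simp
  \<comment> \<open>\<open>z\<close> is \<open>\<alpha> / (\<alpha> + 1 / real n)\<close> with
    fractions cleared: the i-th power of \<open>\<alpha>\<close> from the step factorial merges with
    the negative power of \<open>\<alpha> + 1 / real n\<close>.\<close>
  define z where "z = real n * \<alpha> / (1 + real n * \<alpha>)"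
  have pos: "1 + real n * \<alpha> > 0" using assms by (simp add: add_pos_nonneg)
  have z: "0 \<le> z" "z < 1" "1 - z = 1 / (1 + real n * \<alpha>)"
    using assms pos by (simp_all add: z_def field_simps)
  have "(\<lambda>i. ((- x / \<alpha>) gchoose i) * (- z) ^ i) sums (1 + (- z)) powr (- x / \<alpha>)"
    using z by (intro gen_binomial_real) auto
  then have "(\<lambda>i. (1 + real n * \<alpha>) powr (- x / \<alpha>) * (((- x / \<alpha>) gchoose i) * (- z) ^ i)) sums
      ((1 + real n * \<alpha>) powr (- x / \<alpha>) * (1 - z) powr (- x / \<alpha>))"
    by (intro sums_mult) simp
  also have "(1 + real n * \<alpha>) powr (- x / \<alpha>) * (1 - z) powr (- x / \<alpha>) = 1"
    using pos by (simp add: z(3) flip: powr_mult)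
  also have "(\<lambda>i. (1 + real n * \<alpha>) powr (- x / \<alpha>) * (((- x / \<alpha>) gchoose i) * (- z) ^ i)) = weight n \<alpha> x"
  proof
    fix i
    \<comment> \<open>Pulling \<open>\<alpha>\<close> out of each factor leaves a rising factorial
      of \<open>x / \<alpha>\<close>. The generalized binomial coefficient of
      \<open>- x / \<alpha>\<close> is that rising factorial over i! up to the sign (-1)^i, which
      the power of \<open>- z\<close> absorbs.\<close>
    have s: "step_factorial x i \<alpha> = \<alpha> ^ i * pochhammer (x / \<alpha>) i"
      using \<alpha> by (induction i) (simp_all add: step_factorial_def pochhammer_Suc field_simps)
    have "(\<alpha> + 1 / real n) powi (- int i) * \<alpha> ^ i = z ^ i"
      using assms pos by (simp add: z_def power_int_minus field_simps flip: power_mult_distrib power_divide power_inverse)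
    moreover have "((- x / \<alpha>) gchoose i) * (- z) ^ i = z ^ i * (pochhammer (x / \<alpha>) i / fact i)"
      by (simp add: gbinomial_pochhammer power_minus[of z i])
    ultimately show "(1 + real n * \<alpha>) powr (- x / \<alpha>) * (((- x / \<alpha>) gchoose i) * (- z) ^ i) = weight n \<alpha> x i"
      using False by (simp add: weight_def s field_simps)
  qed
  finally show ?thesis .
qed

text \<open>Ratio test: the quadratic factor does not change the limit of the ratio, which is
  \<open>\<alpha> / (\<alpha> + 1 / real n)\<close> and lies below 1.\<close>

lemma weight_quadratic_summable:
  assumes "n > 0" "0 \<le> \<alpha>" "0 \<le> x"
  shows "summable (\<lambda>i. weight n \<alpha> x i * (real i + 1)\<^sup>2)"
proof -
  \<comment> \<open>The quotient of consecutive terms: the factor from \<open>weight_Suc\<close>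
    times (i+2)^2/(i+1)^2.\<close>
  define q where "q i = (x + real i * \<alpha>) * (real i + 2)\<^sup>2 / ((real i + 1) ^ 3 * (\<alpha> + 1 / real n))" for i
  have p: "\<alpha> + 1 / real n > 0" using assms by (simp add: add_nonneg_pos)
  have "(\<lambda>i. ((x + real i * \<alpha>) * (real i + 2)\<^sup>2 / (real i + 1) ^ 3) / (\<alpha> + 1 / real n))
      \<longlonglongrightarrow> \<alpha> / (\<alpha> + 1 / real n)"
  proof (rule tendsto_divide[OF _ tendsto_const])
    \<comment> \<open>Splitting off x and \<open>\<alpha>\<close> leaves limits of parameter-free
      rational functions of i.\<close>
    have "(\<lambda>i. x * ((real i + 2)\<^sup>2 / (real i + 1) ^ 3) + \<alpha> * (real i * (real i + 2)\<^sup>2 / (real i + 1) ^ 3))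
        \<longlonglongrightarrow> x * 0 + \<alpha> * 1"
      by (intro tendsto_add tendsto_mult tendsto_const; real_asymp)
    then show "(\<lambda>i. (x + real i * \<alpha>) * (real i + 2)\<^sup>2 / (real i + 1) ^ 3) \<longlonglongrightarrow> \<alpha>"
      by (simp add: add_divide_distrib algebra_simps)
  qed (use p in simp)
  then have lim: "q \<longlonglongrightarrow> \<alpha> / (\<alpha> + 1 / real n)"
    by (simp add: q_def[abs_def])
  have "\<alpha> / (\<alpha> + 1 / real n) < 1" using p assms by simp
  then obtain c where c: "\<alpha> / (\<alpha> + 1 / real n) < c" "c < 1" using dense by blast
  obtain N where N: "\<And>i. i \<ge> N \<Longrightarrow> q i < c"
    using order_tendstoD(2)[OF lim c(1)] by (auto simp: eventually_sequentially)
  show ?thesis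
  proof (rule summable_ratio_test[OF c(2)])
    fix i assume "i \<ge> N"
    have "weight n \<alpha> x (Suc i) * (real (Suc i) + 1)\<^sup>2 = q i * (weight n \<alpha> x i * (real i + 1)\<^sup>2)"
      using p unfolding weight_Suc[OF assms(1,2)] q_def
      by (simp add: divide_simps power2_eq_square power3_eq_cube add.commute[of 2])
    also have "\<dots> \<le> c * (weight n \<alpha> x i * (real i + 1)\<^sup>2)"
      using N[OF \<open>i \<ge> N\<close>] weight_nonneg[OF assms(2,3)] by (intro mult_right_mono) auto
    finally show "norm (weight n \<alpha> x (Suc i) * (real (Suc i) + 1)\<^sup>2)
        \<le> c * norm (weight n \<alpha> x i * (real i + 1)\<^sup>2)"
      using weight_nonneg[OF assms(2,3)] by simp
  qed
qed

section \<open>The operator on quadratics and on functions they dominate\<close>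

lemma U_op_gamma_kernel:
  "U_op n \<alpha> f x = real n * (\<Sum>i. weight n \<alpha> x i * (LBINT u:{0..}. gamma_kernel n i u * f u))"
  by (simp add: U_op_def gamma_kernel_def)

text \<open>The inner integrals grow at most like (i+1)^2. Summability ensures that the
  \<open>suminf\<close> in the second central moment is a genuine sum.\<close>

lemma second_moment_summable:
  assumes "n > 0" "0 \<le> \<alpha>" "0 \<le> x"
  shows "summable (\<lambda>i. weight n \<alpha> x i * (LBINT u:{0..}. gamma_kernel n i u * (u - x)\<^sup>2))"
proof (rule summable_comparison_test'[OF summable_mult, where N = 0])
  show "summable (\<lambda>i. weight n \<alpha> x i * (real i + 1)\<^sup>2)"
    by (rule weight_quadratic_summable[OF assms])
  fix i
  define a where "a = (real i + 1) / real n"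
  \<comment> \<open>The cross term -2ax is dropped as a and x are nonnegative; the factor (i+1)^2 at
    least 1 gives all terms a common majorant.\<close>
  have "(a - x)\<^sup>2 \<le> a\<^sup>2 + x\<^sup>2 * (real i + 1)\<^sup>2"
  proof -
    have "x\<^sup>2 * 1 \<le> x\<^sup>2 * (real i + 1)\<^sup>2" by (intro mult_left_mono) auto
    moreover have "0 \<le> a * x" using assms by (simp add: a_def)
    ultimately show ?thesis by (simp add: power2_diff)
  qed
  then have "(a - x)\<^sup>2 / real n \<le> (a\<^sup>2 + x\<^sup>2 * (real i + 1)\<^sup>2) / real n"
    by (rule divide_right_mono) simp
  also have "\<dots> = (1 / real n ^ 3 + x\<^sup>2 / real n) * (real i + 1)\<^sup>2"
    unfolding add_divide_distrib unfolding a_def power_divide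
    by (simp add: distrib_right power3_eq_cube power2_eq_square[of "real n"])
  finally have "(a - x)\<^sup>2 / real n \<le> (1 / real n ^ 3 + x\<^sup>2 / real n) * (real i + 1)\<^sup>2" .
  moreover have "(real i + 1) / real n ^ 3 \<le> (1 / real n ^ 3) * (real i + 1)\<^sup>2"
    by (simp add: divide_right_mono power2_eq_square)
  ultimately have "(LBINT u:{0..}. gamma_kernel n i u * (u - x)\<^sup>2)
      \<le> (2 / real n ^ 3 + x\<^sup>2 / real n) * (real i + 1)\<^sup>2"
    unfolding gamma_kernel_second_moment(2)[OF assms(1)] a_def[symmetric] by (simp add: algebra_simps)
  then have "weight n \<alpha> x i * (LBINT u:{0..}. gamma_kernel n i u * (u - x)\<^sup>2)
      \<le> weight n \<alpha> x i * ((2 / real n ^ 3 + x\<^sup>2 / real n) * (real i + 1)\<^sup>2)"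
    by (intro mult_left_mono weight_nonneg assms)
  then show "norm (weight n \<alpha> x i * (LBINT u:{0..}. gamma_kernel n i u * (u - x)\<^sup>2))
      \<le> (2 / real n ^ 3 + x\<^sup>2 / real n) * (weight n \<alpha> x i * (real i + 1)\<^sup>2)"
    using weight_nonneg[OF assms(2,3)] by (simp add: gamma_kernel_second_moment(2)[OF assms(1)] mult_ac)
qed

text \<open>The term i = 0 is already strictly positive and the others are nonnegative. Positivity
  is what allows the tangent to be taken at this moment.\<close>

lemma second_central_moment_pos:
  assumes "n > 0" "0 \<le> \<alpha>" "0 \<le> x"
  shows "0 < second_central_moment n \<alpha> x"
proof -
  have pos: "0 < (LBINT u:{0..}. gamma_kernel n i u * (u - x)\<^sup>2)" for i
    unfolding gamma_kernel_second_moment(2)[OF assms(1)] using assms(1)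
    by (intro add_nonneg_pos) auto
  have "0 < (\<Sum>i. weight n \<alpha> x i * (LBINT u:{0..}. gamma_kernel n i u * (u - x)\<^sup>2))"
    using weight_0_pos[OF assms(1,2)] pos weight_nonneg[OF assms(2,3)]
    by (intro suminf_pos2[OF second_moment_summable[OF assms], of 0]) (auto simp: less_imp_le)
  then show ?thesis
    using assms(1) by (simp add: second_central_moment_def U_op_gamma_kernel)
qed

text \<open>Positivity and linearity of the operator in one statement. The quadratic majorant also
  supplies integrability of each inner integrand and absolute summability of the outer series;
  continuity supplies measurability.\<close>

lemma U_op_quadratic_bound:
  assumes "n > 0" "0 \<le> \<alpha>" "0 \<le> x" and cont: "continuous_on {0..} f"
    and bound: "\<And>u. u \<ge> 0 \<Longrightarrow> \<bar>f u - f x\<bar> \<le> A + B * (u - x)\<^sup>2"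
  shows "\<bar>U_op n \<alpha> f x - f x\<bar> \<le> A + B * second_central_moment n \<alpha> x"
proof -
  define Q where "Q i = (LBINT u:{0..}. gamma_kernel n i u * (u - x)\<^sup>2)" for i
  define I where "I i = (LBINT u:{0..}. gamma_kernel n i u * f u)" for i
  note w0 = weight_nonneg[OF assms(2,3), of n]
  note k1 = gamma_kernel_integral_one[OF assms(1)]
  note k2 = gamma_kernel_second_moment(1)[OF assms(1)]
  have maj: "set_integrable lborel {0..} (\<lambda>u. A * gamma_kernel n i u + B * (gamma_kernel n i u * (u - x)\<^sup>2))"
    and majI: "(LBINT u:{0..}. A * gamma_kernel n i u + B * (gamma_kernel n i u * (u - x)\<^sup>2)) = A / real n + B * Q i" for i
    using k1[of i] k2[of i x] by (simp_all add: set_integral_add Q_def)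
  have bd: "\<bar>gamma_kernel n i u * f u - f x * gamma_kernel n i u\<bar>
      \<le> A * gamma_kernel n i u + B * (gamma_kernel n i u * (u - x)\<^sup>2)" if "u \<ge> 0" for i u
  proof -
    have "\<bar>gamma_kernel n i u * f u - f x * gamma_kernel n i u\<bar> = gamma_kernel n i u * \<bar>f u - f x\<bar>"
      using gamma_kernel_nonneg[OF that] by (simp add: abs_mult flip: right_diff_distrib mult.commute[of "gamma_kernel n i u" "f x"])
    also have "\<dots> \<le> gamma_kernel n i u * (A + B * (u - x)\<^sup>2)"
      using bound[OF that] gamma_kernel_nonneg[OF that] by (rule mult_left_mono)
    finally show ?thesis by (simp add: algebra_simps)
  qed
  have meas: "set_borel_measurable lborel {0..} (\<lambda>u. gamma_kernel n i u * f u - f x * gamma_kernel n i u)" for i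
  proof -
    have "continuous_on {0..} (\<lambda>u. gamma_kernel n i u * f u - f x * gamma_kernel n i u)"
      unfolding gamma_kernel_def by (intro continuous_intros cont) auto
    from borel_measurable_continuous_on_indicator[OF _ this] show ?thesis
      by (simp add: set_borel_measurable_def)
  qed
  \<comment> \<open>The deviation from \<open>f x\<close> is dominated first; adding back the
    integrable multiple of the kernel then yields integrability for f itself.\<close>
  have dint: "set_integrable lborel {0..} (\<lambda>u. gamma_kernel n i u * f u - f x * gamma_kernel n i u)" for i
    by (rule set_integrable_bound[OF maj[of i] meas]) (use bd in \<open>force intro: order_trans[OF _ abs_ge_self]\<close>)
  have fint: "set_integrable lborel {0..} (\<lambda>u. gamma_kernel n i u * f u)" for i
    using set_integral_add(1)[OF dint[of i] set_integrable_mult_right[of "f x", OF k1(1)[of i]]] by simp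
  have dI: "(LBINT u:{0..}. gamma_kernel n i u * f u - f x * gamma_kernel n i u) = I i - f x / real n" for i
    using fint[of i] k1[of i] by (simp add: set_integral_diff I_def)
  have I_le: "\<bar>I i - f x / real n\<bar> \<le> A / real n + B * Q i" for i
  proof -
    have "\<bar>I i - f x / real n\<bar> \<le> (LBINT u:{0..}. \<bar>gamma_kernel n i u * f u - f x * gamma_kernel n i u\<bar>)"
      unfolding dI[symmetric] using set_integral_norm_bound[OF dint[of i]] by simp
    also have "\<dots> \<le> A / real n + B * Q i"
      unfolding majI[symmetric]
      by (intro set_integral_mono maj set_integrable_abs dint bd) auto
    finally show ?thesis .
  qed
  have le: "norm (weight n \<alpha> x i * (I i - f x / real n)) \<le> weight n \<alpha> x i * (A / real n) + B * (weight n \<alpha> x i * Q i)" for i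
  proof -
    have "norm (weight n \<alpha> x i * (I i - f x / real n)) = weight n \<alpha> x i * \<bar>I i - f x / real n\<bar>"
      by (simp add: abs_mult w0)
    also have "\<dots> \<le> weight n \<alpha> x i * (A / real n + B * Q i)"
      using I_le w0 by (rule mult_left_mono)
    finally show ?thesis by (simp add: algebra_simps)
  qed
  have wsum: "(\<lambda>i. weight n \<alpha> x i * c) sums c" for c
    using sums_mult2[OF weight_sums_1[OF assms(1,2)], of x c] by simp
  have "(\<lambda>i. weight n \<alpha> x i * Q i) sums (second_central_moment n \<alpha> x / real n)"
    using summable_sums[OF second_moment_summable[OF assms(1-3)]] assms(1)
    by (simp add: second_central_moment_def U_op_gamma_kernel Q_def)
  then have rhs: "(\<lambda>i. weight n \<alpha> x i * (A / real n) + B * (weight n \<alpha> x i * Q i))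
      sums (A / real n + B * (second_central_moment n \<alpha> x / real n))"
    by (intro sums_add wsum sums_mult)
  have sd: "summable (\<lambda>i. norm (weight n \<alpha> x i * (I i - f x / real n)))"
    using le by (intro summable_comparison_test'[OF sums_summable[OF rhs], where N = 0]) auto
  \<comment> \<open>The constant part is added back using total weight 1, which recovers the series
    defining \<open>U_op n \<alpha> f x\<close>.\<close>
  have "(\<lambda>i. weight n \<alpha> x i * (I i - f x / real n) + weight n \<alpha> x i * (f x / real n))
      sums ((\<Sum>i. weight n \<alpha> x i * (I i - f x / real n)) + f x / real n)"
    by (intro sums_add wsum summable_sums summable_norm_cancel[OF sd])
  then have "(\<lambda>i. weight n \<alpha> x i * I i) sums ((\<Sum>i. weight n \<alpha> x i * (I i - f x / real n)) + f x / real n)"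
    by (simp add: algebra_simps)
  then have "U_op n \<alpha> f x - f x = real n * (\<Sum>i. weight n \<alpha> x i * (I i - f x / real n))"
    using assms(1) by (simp add: U_op_gamma_kernel I_def sums_iff algebra_simps)
  also have "\<bar>\<dots>\<bar> \<le> real n * (A / real n + B * (second_central_moment n \<alpha> x / real n))"
  proof -
    have "\<bar>\<Sum>i. weight n \<alpha> x i * (I i - f x / real n)\<bar>
        \<le> (\<Sum>i. norm (weight n \<alpha> x i * (I i - f x / real n)))"
      using summable_norm[OF sd] by simp
    also have "\<dots> \<le> A / real n + B * (second_central_moment n \<alpha> x / real n)"
      using suminf_le[OF le sd sums_summable[OF rhs]] sums_unique[OF rhs] by simp
    finally show ?thesis by (simp add: abs_mult mult_left_mono)
  qed
  also have "\<dots> = A + B * second_central_moment n \<alpha> x"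
    using assms(1) by (simp add: field_simps)
  finally show ?thesis .
qed

section \<open>The tangent majorant and the Lipschitz condition\<close>

text \<open>For y > 0 this is Young's inequality for \<open>y / \<theta>\<close> and 1 with weights
  p and 1-p, multiplied by \<open>\<theta> powr p\<close>.\<close>

lemma powr_le_tangent:
  fixes y \<theta> p :: real
  assumes "0 \<le> y" "0 < \<theta>" "0 < p" "p \<le> 1"
  shows "y powr p \<le> (1 - p) * \<theta> powr p + p * \<theta> powr (p - 1) * y"
proof (cases "y = 0")
  case True
  then show ?thesis using assms by simp
next
  case False
  then have y: "y > 0" using assms by simp
  have "(y / \<theta>) powr p * 1 powr (1 - p) \<le> p * (y / \<theta>) + (1 - p) * 1"
    using assms y by (intro Youngs_inequality_0) auto
  then have "\<theta> powr p * (y / \<theta>) powr p \<le> \<theta> powr p * (p * (y / \<theta>) + (1 - p))"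
    by (intro mult_left_mono) auto
  then show ?thesis
    using assms y by (simp add: powr_divide powr_diff field_simps)
qed

text \<open>With j = u and k = x the denominator has base u + c for c =
  \<open>x * (x * l1 + l2)\<close>; replacing it by the smaller c > 0 enlarges the quotient and
  removes the dependence on u.\<close>

lemma Lip_deviation:
  assumes "f \<in> Lip M l1 l2 s" "0 < s" "0 < x" "0 < x * (x * l1 + l2)"
  shows "0 \<le> M"
    and "u \<ge> 0 \<Longrightarrow> \<bar>f u - f x\<bar> \<le> M / (x * (x * l1 + l2)) powr (s / 2) * ((u - x)\<^sup>2) powr (s / 2)"
proof -
  let ?c = "x * (x * l1 + l2)"
  have L: "\<bar>f u - f x\<bar> \<le> M * (\<bar>u - x\<bar> powr s / (u + ?c) powr (s / 2))" if "u \<ge> 0" for u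
  proof -
    have "u + x\<^sup>2 * l1 + x * l2 = u + ?c" by (simp add: power2_eq_square algebra_simps)
    moreover have "0 < u + ?c" using assms(4) that by simp
    moreover have "0 < u + x\<^sup>2 * l1 + x * l2 \<longrightarrow>
        \<bar>f u - f x\<bar> \<le> M * (\<bar>u - x\<bar> powr s / (u + x\<^sup>2 * l1 + x * l2) powr (s / 2))"
      using assms(1,3) that unfolding Lip_def by simp
    ultimately show ?thesis by metis
  qed
  \<comment> \<open>The sign of M is read off at u = 0, where M is multiplied by a strictly positive
    quotient.\<close>
  have "0 \<le> M * (x powr s / ?c powr (s / 2))"
    using order_trans[OF abs_ge_zero L[of 0]] assms by simp
  moreover have "0 < x powr s / ?c powr (s / 2)"
    using assms(3,4) by (metis divide_pos_pos powr_gt_zero less_irrefl)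
  ultimately show M: "0 \<le> M"
    by (metis mult.commute zero_le_mult_iff not_le less_le)
  assume u: "u \<ge> 0"
  have "\<bar>u - x\<bar> powr s / (u + ?c) powr (s / 2) \<le> \<bar>u - x\<bar> powr s / ?c powr (s / 2)"
    using u assms by (intro divide_left_mono powr_mono2 mult_pos_pos) auto
  then have "\<bar>f u - f x\<bar> \<le> M * (\<bar>u - x\<bar> powr s / ?c powr (s / 2))"
    using L[OF u] M by (meson mult_left_mono order_trans)
  \<comment> \<open>Writing the power in terms of the square turns the bound into a concave function
    of the quantity whose operator value is the second central moment.\<close>
  also have "\<bar>u - x\<bar> powr s = ((u - x)\<^sup>2) powr (s / 2)"
    using powr_powr[of "\<bar>u - x\<bar>" 2 "s / 2"] by simp
  finally show "\<bar>f u - f x\<bar> \<le> M / ?c powr (s / 2) * ((u - x)\<^sup>2) powr (s / 2)"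
    by simp
qed

theorem theorem3p3:
  fixes n :: nat and \<alpha> l1 l2 M s x :: real and f :: "real \<Rightarrow> real"
  assumes "n \<ge> 1" and "0 \<le> \<alpha>" and "\<alpha> \<le> 1 / real n"
    and "0 < s" and "s \<le> 1"
    and "f \<in> Lip M l1 l2 s"
    and "x \<ge> 0" and "0 < x * (x * l1 + l2)"
  shows "\<bar>U_op n \<alpha> f x - f x\<bar>
           \<le> M * (second_central_moment n \<alpha> x / (x * (x * l1 + l2))) powr (s / 2)"
proof -
  define \<theta> where "\<theta> = second_central_moment n \<alpha> x"
  define p where "p = s / 2"
  define D where "D = M / (x * (x * l1 + l2)) powr p"
  have n: "n > 0" and p: "0 < p" "p \<le> 1" and x: "x > 0"
    using assms by (auto simp: p_def less_le)
  have \<theta>: "\<theta> > 0"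
    unfolding \<theta>_def using n assms by (intro second_central_moment_pos)
  note dev = Lip_deviation[OF assms(6,4) x assms(8), folded p_def, folded D_def]
  have D: "D \<ge> 0" using dev(1) by (simp add: D_def)
  \<comment> \<open>The tangent inequality at y = (u-x)^2, scaled by D, takes the form A + B (u-x)^2
    required by \<open>U_op_quadratic_bound\<close>.\<close>
  have "\<bar>f u - f x\<bar> \<le> D * ((1 - p) * \<theta> powr p) + D * (p * \<theta> powr (p - 1)) * (u - x)\<^sup>2" if "u \<ge> 0" for u
    using dev(2)[OF that] mult_left_mono[OF powr_le_tangent[OF _ \<theta> p, of "(u - x)\<^sup>2"] D]
    by (simp add: algebra_simps)
  moreover have "continuous_on {0..} f" using assms(6) by (simp add: Lip_def CB_def)
  ultimately have "\<bar>U_op n \<alpha> f x - f x\<bar> \<le> D * ((1 - p) * \<theta> powr p) + D * (p * \<theta> powr (p - 1)) * \<theta>"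
    unfolding \<theta>_def using n assms by (intro U_op_quadratic_bound) auto
  \<comment> \<open>At the point of contact the tangent value is \<open>\<theta> powr p\<close>
    itself, so no constant is lost.\<close>
  also have "\<dots> = D * \<theta> powr p"
    using \<theta> by (simp add: powr_diff field_simps)
  also have "\<dots> = M * (\<theta> / (x * (x * l1 + l2))) powr p"
    using \<theta> assms(8) by (simp add: D_def powr_divide)
  finally show ?thesis unfolding \<theta>_def p_def .
qed

end
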